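(* If a contact configuration $W$ satisfies $|W\cap R|\ge22$ for some root system $R$, then $W\subseteq R$.
   Context: A contact configuration is a finite set $W\subset S^3\subset\mathbb{R}^4$ of unit vectors with $\langle w,w'\rangle\le\frac12$ for all distinct $w,w'\in W$. Here a root system means the image under an orthogonal map of $\mathbb{R}^4$ of the set of $24$ normalised $D_4$ roots $(\pm e_i\pm e_j)/\sqrt2$, $1\le i<j\le4$. *)

theory Defs
  imports "HOL-Analysis.Analysis"
begin

definition contact_configuration :: "(real ^ 4) set \<Rightarrow> bool" where
  "contact_configuration W \<longleftrightarrow>
     finite W \<and> W \<subseteq> sphere 0 1 \<and>
     (\<forall>w\<in>W. \<forall>w'\<in>W. w \<noteq> w' \<longrightarrow> w \<bullet> w' \<le> 1/2)"

(* In the index type 4 the numeral 4 equals 0, so the order is 4 < 1 < 2 < 3. As the two signs are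
   independent, the set below does not depend on which linear order of the indices is used. *)
definition D4_roots :: "(real ^ 4) set" where
  "D4_roots =
     {(1 / sqrt 2) *\<^sub>R (s *\<^sub>R axis i 1 + t *\<^sub>R axis j 1) | s t i j.
        s \<in> {-1, 1} \<and> t \<in> {-1, 1} \<and> i < j}"

definition root_system :: "(real ^ 4) set \<Rightarrow> bool" where
  "root_system R \<longleftrightarrow> (\<exists>f. orthogonal_transformation f \<and> R = f ` D4_roots)"

end

theory Submission
  imports Defs
begin

text \<open>
  After an orthogonal map, \<open>R\<close> is the standard system. Its 24 roots split into three groups of
  eight, one for each way of partitioning the coordinates into two pairs. As at most two roots are
  missing from \<open>W\<close>, some group \<open>{i, j}, {k, l}\<close> lies entirely in \<open>W\<close>. For \<open>x\<close> in \<open>W\<close> outside that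
  group the contact conditions give \<open>\<bar>x\<^sub>i\<bar> + \<bar>x\<^sub>j\<bar> \<le> 1/\<surd>2\<close> and \<open>\<bar>x\<^sub>k\<bar> + \<bar>x\<^sub>l\<bar> \<le> 1/\<surd>2\<close>, whence
  \<open>1 = \<bar>x\<bar>\<^sup>2 \<le> 1/2 + 1/2\<close>. Equality forces one coordinate of each pair to vanish and the other to be
  \<open>\<plusminus>1/\<surd>2\<close>, so \<open>x\<close> is a root.
\<close>

text \<open>No order is imposed on \<open>i\<close> and \<open>j\<close>, so the three groups can be
  named freely although \<open>4\<close> is the least index.\<close>

definition pair_roots :: "4 \<Rightarrow> 4 \<Rightarrow> (real ^ 4) set" where
  "pair_roots i j =
     (\<lambda>(s, t). (1 / sqrt 2) *\<^sub>R (s *\<^sub>R axis i 1 + t *\<^sub>R axis j 1)) ` ({-1, 1} \<times> {-1, 1})"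

lemma pair_rootsI:
  "\<lbrakk>s \<in> {-1, 1}; t \<in> {-1, 1}\<rbrakk>
    \<Longrightarrow> (1 / sqrt 2) *\<^sub>R (s *\<^sub>R axis i 1 + t *\<^sub>R axis j 1) \<in> pair_roots i j"
  unfolding pair_roots_def by (rule image_eqI[where x = "(s, t)"]) auto

lemma pair_rootsE:
  assumes "r \<in> pair_roots i j"
  obtains s t where "s \<in> {-1, 1}" "t \<in> {-1, 1}"
    "r = (1 / sqrt 2) *\<^sub>R (s *\<^sub>R axis i 1 + t *\<^sub>R axis j 1)"
  using assms that unfolding pair_roots_def by (elim imageE SigmaE) simp

lemma finite_pair_roots [simp]: "finite (pair_roots i j)"
  by (simp add: pair_roots_def)

lemma card_pair_roots_le: "card (pair_roots i j) \<le> 4"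
proof -
  have "card (pair_roots i j) \<le> card ({-1, 1 :: real} \<times> {-1, 1 :: real})"
    unfolding pair_roots_def by (rule card_image_le) simp
  then show ?thesis by (simp add: card_cartesian_product)
qed

lemma pair_roots_commute: "pair_roots i j = pair_roots j i"
proof -
  have "pair_roots i j \<subseteq> pair_roots j i" for i j
  proof
    fix r assume "r \<in> pair_roots i j"
    then obtain s t where st: "s \<in> {-1, 1}" "t \<in> {-1, 1}"
      and r: "r = (1 / sqrt 2) *\<^sub>R (s *\<^sub>R axis i 1 + t *\<^sub>R axis j 1)"
      by (rule pair_rootsE)
    show "r \<in> pair_roots j i"
      unfolding r by (subst add.commute) (rule pair_rootsI[OF st(2,1)])
  qed
  then show ?thesis by blast
qed

lemma D4_rootsE:
  assumes "r \<in> D4_roots"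
  obtains i j where "i \<noteq> j" "r \<in> pair_roots i j"
proof -
  obtain s t i j where st: "s \<in> {-1, 1}" "t \<in> {-1, 1}" and ij: "i < j"
    and r: "r = (1 / sqrt 2) *\<^sub>R (s *\<^sub>R axis i 1 + t *\<^sub>R axis j 1)"
    using assms unfolding D4_roots_def by blast
  have "r \<in> pair_roots i j" unfolding r by (rule pair_rootsI[OF st])
  with less_imp_neq[OF ij] show ?thesis by (rule that)
qed

lemma pair_roots_subset_D4_roots:
  assumes "i \<noteq> j"
  shows "pair_roots i j \<subseteq> D4_roots"
proof -
  have "pair_roots i j \<subseteq> D4_roots" if "i < j" for i j
  proof
    fix r assume "r \<in> pair_roots i j"
    then obtain s t where "s \<in> {-1, 1}" "t \<in> {-1, 1}"
      and "r = (1 / sqrt 2) *\<^sub>R (s *\<^sub>R axis i 1 + t *\<^sub>R axis j 1)"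
      by (rule pair_rootsE)
    with that show "r \<in> D4_roots" unfolding D4_roots_def by blast
  qed
  then show ?thesis using assms by (metis linorder_neqE pair_roots_commute)
qed

text \<open>Each of the six edges on four indices lies in one of the three perfect matchings;
  swapping the indices settles the edges listed in the other order.\<close>

lemma D4_roots_subset_matchings:
  "D4_roots \<subseteq> (pair_roots 1 2 \<union> pair_roots 3 4) \<union> (pair_roots 1 3 \<union> pair_roots 2 4)
    \<union> (pair_roots 1 4 \<union> pair_roots 2 3)"
proof
  fix r assume "r \<in> D4_roots"
  then obtain i j where "i \<noteq> j" "r \<in> pair_roots i j" by (rule D4_rootsE)
  then show "r \<in> (pair_roots 1 2 \<union> pair_roots 3 4) \<union> (pair_roots 1 3 \<union> pair_roots 2 4)
    \<union> (pair_roots 1 4 \<union> pair_roots 2 3)"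
    using exhaust_4[of i] exhaust_4[of j]
    by (elim disjE) (auto simp: pair_roots_commute[of 2 1] pair_roots_commute[of 3 1]
        pair_roots_commute[of 4 1] pair_roots_commute[of 3 2] pair_roots_commute[of 4 2]
        pair_roots_commute[of 4 3])
qed

text \<open>All four sign choices occur among the roots, and one of them turns
  \<open>s * x $ i + t * x $ j\<close> into the sum of absolute values.\<close>

lemma abs_add_abs_le_if_contact_pair_roots:
  assumes "\<forall>r\<in>pair_roots i j. x \<bullet> r \<le> 1/2"
  shows "\<bar>x $ i\<bar> + \<bar>x $ j\<bar> \<le> sqrt 2 / 2"
proof -
  have le: "s * x $ i + t * x $ j \<le> sqrt 2 / 2" if "s \<in> {-1, 1}" "t \<in> {-1, 1}" for s t
  proof -
    have "x \<bullet> ((1 / sqrt 2) *\<^sub>R (s *\<^sub>R axis i 1 + t *\<^sub>R axis j 1)) \<le> 1/2"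
      using assms pair_rootsI[OF that] by blast
    then show ?thesis
      by (simp add: inner_add_right inner_axis field_simps)
  qed
  show ?thesis
    using le[of 1 1] le[of 1 "-1"] le[of "-1" 1] le[of "-1" "-1"] by (auto simp: abs_if)
qed

text \<open>After scaling by \<open>sqrt 2\<close>, the two nonzero coordinates are themselves the
  signs \<open>s\<close> and \<open>t\<close> of the root.\<close>

lemma root_if_two_coordinates:
  fixes x :: "real ^ 4"
  assumes "a \<noteq> b" "(x $ a)\<^sup>2 = 1/2" "(x $ b)\<^sup>2 = 1/2" "\<And>m. m \<noteq> a \<Longrightarrow> m \<noteq> b \<Longrightarrow> x $ m = 0"
  shows "x \<in> D4_roots"
proof -
  have sign: "sqrt 2 * y \<in> {-1, 1}" if "y\<^sup>2 = 1/2" for y :: real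
  proof -
    have "(sqrt 2 * y)\<^sup>2 = 1" using that by (simp add: power_mult_distrib)
    then show ?thesis by (auto simp: power2_eq_1_iff)
  qed
  have "x = (1 / sqrt 2) *\<^sub>R ((sqrt 2 * x $ a) *\<^sub>R axis a 1 + (sqrt 2 * x $ b) *\<^sub>R axis b 1)"
    using assms(1,4) by (auto simp: vec_eq_iff axis_def)
  then have "x \<in> pair_roots a b"
    using pair_rootsI[OF sign[OF assms(2)] sign[OF assms(3)]] by metis
  then show ?thesis using pair_roots_subset_D4_roots[OF assms(1)] by blast
qed

text \<open>The cross term is kept on the left because the equality case has to force it to
  vanish.\<close>

lemma sum_squares_le_half:
  fixes a b :: real
  assumes "\<bar>a\<bar> + \<bar>b\<bar> \<le> sqrt 2 / 2"
  shows "a\<^sup>2 + b\<^sup>2 + 2 * \<bar>a * b\<bar> \<le> 1/2"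
proof -
  have "(\<bar>a\<bar> + \<bar>b\<bar>)\<^sup>2 \<le> (sqrt 2 / 2)\<^sup>2"
    using assms by (intro power_mono) auto
  then show ?thesis by (simp add: power2_sum abs_mult power_divide)
qed

lemma root_if_contact_matching:
  fixes x :: "real ^ 4"
  assumes indices: "i \<noteq> j" "i \<noteq> k" "i \<noteq> l" "j \<noteq> k" "j \<noteq> l" "k \<noteq> l"
    and norm: "norm x = 1"
    and contact: "\<forall>r \<in> pair_roots i j \<union> pair_roots k l. x \<bullet> r \<le> 1/2"
  shows "x \<in> D4_roots"
proof -
  \<comment> \<open>Four distinct indices exhaust the type, so the squared norm is the sum of these
    four squares.\<close>
  have "card {i, j, k, l} = card (UNIV :: 4 set)" using indices by simp
  then have UNIV: "UNIV = {i, j, k, l}" by (metis card_subset_eq finite subset_UNIV)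
  then have ex: "m = i \<or> m = j \<or> m = k \<or> m = l" for m by blast
  have "x \<bullet> x = 1" using norm by (simp add: dot_square_norm)
  then have sum: "(x $ i)\<^sup>2 + (x $ j)\<^sup>2 + (x $ k)\<^sup>2 + (x $ l)\<^sup>2 = 1"
    using indices by (simp add: inner_vec_def UNIV power2_eq_square)
  have ij: "(x $ i)\<^sup>2 + (x $ j)\<^sup>2 + 2 * \<bar>x $ i * x $ j\<bar> \<le> 1/2"
    and kl: "(x $ k)\<^sup>2 + (x $ l)\<^sup>2 + 2 * \<bar>x $ k * x $ l\<bar> \<le> 1/2"
    using contact by (intro sum_squares_le_half abs_add_abs_le_if_contact_pair_roots; blast)+
  \<comment> \<open>Adding \<open>ij\<close> and \<open>kl\<close> and subtracting
    \<open>sum\<close> bounds the two nonnegative cross terms by 0; then both half-sums must attain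
    1/2.\<close>
  have zero: "\<bar>x $ i * x $ j\<bar> = 0" "\<bar>x $ k * x $ l\<bar> = 0"
    and half: "(x $ i)\<^sup>2 + (x $ j)\<^sup>2 = 1/2" "(x $ k)\<^sup>2 + (x $ l)\<^sup>2 = 1/2"
    using sum ij kl by linarith+
  \<comment> \<open>\<open>a'\<close> is the vanishing coordinate of the pair, \<open>a\<close> the
    one carrying the whole mass 1/2.\<close>
  obtain a a' where a: "{a, a'} = {i, j}" "x $ a' = 0" "(x $ a)\<^sup>2 = 1/2"
    using zero(1) half(1) by (cases "x $ i = 0") auto
  obtain b b' where b: "{b, b'} = {k, l}" "x $ b' = 0" "(x $ b)\<^sup>2 = 1/2"
    using zero(2) half(2) by (cases "x $ k = 0") auto
  show ?thesis
  proof (rule root_if_two_coordinates)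
    show "a \<noteq> b" using a(1) b(1) indices by (auto simp: doubleton_eq_iff)
    show "x $ m = 0" if "m \<noteq> a" "m \<noteq> b" for m
      using ex[of m] a(1,2) b(1,2) that by (auto simp: doubleton_eq_iff)
  qed (use a b in auto)
qed

text \<open>A group has at most 4 + 4 roots, and at least one of them is missing from
  \<open>W\<close>.\<close>

lemma card_Int_matching_le_7:
  assumes "\<not> pair_roots i j \<union> pair_roots k l \<subseteq> W"
  shows "card (W \<inter> (pair_roots i j \<union> pair_roots k l)) \<le> 7"
proof -
  let ?A = "pair_roots i j \<union> pair_roots k l"
  have "card (W \<inter> ?A) < card ?A" using assms by (intro psubset_card_mono) auto
  also have "card ?A \<le> 8"
    using card_Un_le[of "pair_roots i j" "pair_roots k l"] card_pair_roots_le[of i j]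
      card_pair_roots_le[of k l] by linarith
  finally show ?thesis by simp
qed

lemma card_Int_le_if_subset_Un3:
  assumes "finite W" "D \<subseteq> A \<union> B \<union> C"
  shows "card (W \<inter> D) \<le> card (W \<inter> A) + card (W \<inter> B) + card (W \<inter> C)"
proof -
  have "card (W \<inter> D) \<le> card (W \<inter> A \<union> W \<inter> B \<union> W \<inter> C)"
    using assms by (intro card_mono) auto
  also have "\<dots> \<le> card (W \<inter> A) + card (W \<inter> B) + card (W \<inter> C)"
    by (rule order.trans[OF card_Un_le add_right_mono[OF card_Un_le]])
  finally show ?thesis .
qed

lemma contact_configuration_subset_D4_roots:
  assumes W: "contact_configuration W" and card: "card (W \<inter> D4_roots) \<ge> 22"
  shows "W \<subseteq> D4_roots"
proof
  fix x assume x: "x \<in> W"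
  have *: "x \<in> D4_roots"
    if "pair_roots i j \<union> pair_roots k l \<subseteq> W"
      and "i \<noteq> j" "i \<noteq> k" "i \<noteq> l" "j \<noteq> k" "j \<noteq> l" "k \<noteq> l" for i j k l
  \<comment> \<open>The contact bound holds only between distinct points, so an \<open>x\<close>
    inside the group is treated separately.\<close>
  proof (cases "x \<in> pair_roots i j \<union> pair_roots k l")
    case True
    then show ?thesis using pair_roots_subset_D4_roots that(2,7) by blast
  next
    case False
    show ?thesis
    proof (rule root_if_contact_matching)
      show "norm x = 1" using W x by (auto simp: contact_configuration_def)
      show "\<forall>r \<in> pair_roots i j \<union> pair_roots k l. x \<bullet> r \<le> 1/2"
      proof
        fix r assume r: "r \<in> pair_roots i j \<union> pair_roots k l"
        then have "r \<in> W" "x \<noteq> r" using that(1) False by auto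
        then show "x \<bullet> r \<le> 1/2" using W x by (simp add: contact_configuration_def)
      qed
    qed (use that in auto)
  qed
  show "x \<in> D4_roots"
  proof (rule ccontr)
    assume "x \<notin> D4_roots"
    then have "\<not> pair_roots 1 2 \<union> pair_roots 3 4 \<subseteq> W"
      "\<not> pair_roots 1 3 \<union> pair_roots 2 4 \<subseteq> W"
      "\<not> pair_roots 1 4 \<union> pair_roots 2 3 \<subseteq> W"
      using *[of 1 2 3 4] *[of 1 3 2 4] *[of 1 4 2 3] by auto
    \<comment> \<open>If every group misses a root, at most 3 * 7 = 21 roots lie in
      \<open>W\<close>, one short of 22.\<close>
    note this[THEN card_Int_matching_le_7]
    moreover have "card (W \<inter> D4_roots) \<le> card (W \<inter> (pair_roots 1 2 \<union> pair_roots 3 4))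
        + card (W \<inter> (pair_roots 1 3 \<union> pair_roots 2 4))
        + card (W \<inter> (pair_roots 1 4 \<union> pair_roots 2 3))"
      using W by (intro card_Int_le_if_subset_Un3 D4_roots_subset_matchings)
        (simp add: contact_configuration_def)
    ultimately have "card (W \<inter> D4_roots) \<le> 21" by linarith
    with card show False by simp
  qed
qed

text \<open>Inner products and norms are preserved; injectivity keeps the preimage finite and
  distinct points distinct. This moves \<open>W\<close> to the standard roots.\<close>

lemma contact_configuration_vimage_orthogonal:
  assumes "orthogonal_transformation f" "contact_configuration W"
  shows "contact_configuration (f -` W)"
proof -
  have "inj f" using assms(1) by (rule orthogonal_transformation_inj)
  then have "x \<noteq> y \<Longrightarrow> f x \<noteq> f y" for x y by (auto dest: injD)
  moreover have "finite (f -` W)"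
    using \<open>inj f\<close> assms(2) by (auto intro: finite_vimageI simp: contact_configuration_def)
  moreover have "f x \<bullet> f y = x \<bullet> y" "norm (f x) = norm x" for x y
    using assms(1) by (simp_all add: orthogonal_transformation_def orthogonal_transformation_norm)
  ultimately show ?thesis
    using assms(2) unfolding contact_configuration_def
    by (metis (no_types, lifting) mem_sphere_0 subset_iff vimageD)
qed

theorem proposition7p55:
  fixes W R :: "(real ^ 4) set"
  assumes "contact_configuration W"
    and "root_system R"
    and "card (W \<inter> R) \<ge> 22"
  shows "W \<subseteq> R"
proof -
  obtain f where f: "orthogonal_transformation f" and R: "R = f ` D4_roots"
    using assms(2) by (auto simp: root_system_def)
  have "W \<inter> R = f ` (f -` W \<inter> D4_roots)" by (auto simp: R)
  moreover have "card (f ` (f -` W \<inter> D4_roots)) = card (f -` W \<inter> D4_roots)"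
    using orthogonal_transformation_inj[OF f] by (intro card_image) (auto intro: inj_on_subset)
  ultimately have "f -` W \<subseteq> D4_roots"
    using contact_configuration_vimage_orthogonal[OF f assms(1)] assms(3)
    by (intro contact_configuration_subset_D4_roots) auto
  \<comment> \<open>Surjectivity gives \<open>f\<close> (f -\<open>W) = W\<close>, so applying
    \<open>f\<close> carries the inclusion back to \<open>R\<close>.\<close>
  then show ?thesis
    using orthogonal_transformation_surj[OF f] unfolding R by (metis image_mono surj_image_vimage_eq)
qed

end
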